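(* Let $\mathcal{G}$ be an abelian group and let $G_1, G_2$ be subgroups of $\mathcal{G}$ such that $G_1 \cap G_2 = \{0\}$ and $G_2$ is free abelian of finite positive rank $r$. Let $\mathcal{B}$ be a nonempty subset of $G_1$. Then the following statements are equivalent. (1) $\mathcal{B}$ admits a minimal complement in $\mathcal{G}$. (2) $\mathcal{B}$ admits a minimal complement in $G_1$. (3) For every function $u: G_1 \to G_2$, every isomorphism $\varphi : G_2 \to \mathbb{Z}^r$, and every $(u,\varphi)$-bounded spiked subset $X$ of $\mathcal{G}$ with respect to $G_1, G_2$ having $\mathcal{B}$ as its base, the following holds: for any $\varphi$-moderation $v$ of $u$ there is a subset $M' \subseteq G_1$ such that the graph $\{x + v(x) : x \in M'\}$ is a minimal complement of $X$ in $G_1 + G_2$. (4) For some function $u: G_1 \to G_2$, some isomorphism $\varphi : G_2 \to \mathbb{Z}^r$ and some $(u,\varphi)$-bounded spiked subset $X$ of $\mathcal{G}$ with respect to $G_1, G_2$ having $\mathcal{B}$ as its base, the following holds: for any $\varphi$-moderation $v$ of $u$ there is a subset $M' \subseteq G_1$ such that the graph $\{x + v(x) : x \in M'\}$ is a minimal complement of $X$ in $G_1 + G_2$.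
   Context: For an abelian group $G$ and nonempty subsets $W, W' \subseteq G$, $W'$ is a complement of $W$ in $G$ if $W + W' = G$; it is a minimal complement if moreover $W + (W' \setminus \{w'\}) \neq G$ for every $w' \in W'$. Since $G_1 \cap G_2 = \{0\}$, the map $G_1 \times G_2 \to G_1 + G_2$, $(g_1, g_2) \mapsto g_1 + g_2$, is an isomorphism, and $G_1 + G_2$ is identified with $G_1 \times G_2$ (so the graph of $v$ on $M'$ is $\{(x, v(x))\} = \{x + v(x)\}$). $\mathbb{Z}^r$ carries the lexicographic (dictionary) order induced by the order of $\mathbb{Z}$, and $\mathbb{Z}^r_{<a} = \{z \in \mathbb{Z}^r : z < a\}$. A subset $X \subseteq \mathcal{G}$ is spiked with respect to $G_1, G_2$ if $X \subseteq G_1 + G_2$ and $X \supseteq g_1 + G_2$ for some $g_1 \in G_1$; its base is $\{g_1 \in G_1 : g_1 + G_2 \subseteq X\}$. A spiked subset $X$ with base $\mathcal{B}$ is $(u,\varphi)$-bounded, for a function $u : G_1 \to G_2$ and an isomorphism $\varphi : G_2 \to \mathbb{Z}^r$, if $$\mathcal{B} + G_2 \subseteq X \subseteq (\mathcal{B} + G_2) \cup \bigcup_{g_1 \in G_1 \setminus \mathcal{B}} \big(g_1 + \varphi^{-1}(\mathbb{Z}^r_{<\varphi(u(g_1))})\big).$$ A function $v : G_1 \to G_2$ is a $\varphi$-moderation of $u$ if for each $x_0 \in G_1$ the function $x \mapsto \varphi(v(x) + u(x_0 - x))$ on $G_1$ is bounded above in the lexicographic order of $\mathbb{Z}^r$.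
   Formalization: In (4) the function u is additionally required to admit at least one φ-moderation; without this (4) can hold vacuously and the equivalence fails, e.g. for 𝒢 = ℝ×ℤ, 𝓑 = [0,∞), u(0) = 0, u(t) = ⌈1/|t|⌉. For countable G_1 the requirement is automatic. *)

theory Defs
  imports "HOL-Algebra.Free_Abelian_Groups" "HOL-Library.Fun_Lexorder"
begin

text \<open>
  Abelian groups are \<^locale>\<open>comm_group\<close>s in multiplicative notation: \<open>W <#>\<^bsub>G\<^esub> W'\<close> is the sumset
  \<open>W + W'\<close> and \<open>g <#\<^bsub>G\<^esub> W\<close> is the translate \<open>g + W\<close>. A subgroup \<open>H\<close> of \<open>G\<close>, viewed as a group in
  its own right, is \<open>G\<lparr>carrier := H\<rparr>\<close>.
\<close>

definition is_complement :: "('a, 'm) monoid_scheme \<Rightarrow> 'a set \<Rightarrow> 'a set \<Rightarrow> bool" where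
  "is_complement G W W' \<longleftrightarrow>
     W \<noteq> {} \<and> W \<subseteq> carrier G \<and> W' \<noteq> {} \<and> W' \<subseteq> carrier G \<and> W <#>\<^bsub>G\<^esub> W' = carrier G"

definition is_minimal_complement :: "('a, 'm) monoid_scheme \<Rightarrow> 'a set \<Rightarrow> 'a set \<Rightarrow> bool" where
  "is_minimal_complement G W W' \<longleftrightarrow>
     is_complement G W W' \<and> (\<forall>w' \<in> W'. W <#>\<^bsub>G\<^esub> (W' - {w'}) \<noteq> carrier G)"

text \<open>
  Elements of \<open>\<int>\<^sup>r\<close> are functions on \<^typ>\<open>nat\<close> that are \<^const>\<open>undefined\<close> outside \<open>{..<r}\<close>. Two of them
  can therefore only differ at an index below \<open>r\<close>, so that \<^const>\<open>less_fun\<close>, which compares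
  arbitrary functions at the least index where they differ, is the dictionary order on \<open>\<int>\<^sup>r\<close>.
\<close>

definition int_power_group :: "nat \<Rightarrow> (nat \<Rightarrow> int) monoid" where
  "int_power_group r = product_group {..<r} (\<lambda>_. integer_group)"

definition lex_below :: "nat \<Rightarrow> (nat \<Rightarrow> int) \<Rightarrow> (nat \<Rightarrow> int) set" where
  "lex_below r a = {z \<in> carrier (int_power_group r). less_fun z a}"

definition lex_bdd_above :: "nat \<Rightarrow> (nat \<Rightarrow> int) set \<Rightarrow> bool" where
  "lex_bdd_above r Z \<longleftrightarrow>
     (\<exists>b \<in> carrier (int_power_group r). \<forall>z \<in> Z. less_fun z b \<or> z = b)"

definition free_abelian_of_rank :: "('a, 'm) monoid_scheme \<Rightarrow> nat \<Rightarrow> bool" where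
  "free_abelian_of_rank H r \<longleftrightarrow> H \<cong> free_Abelian_group {..<r}"

definition spiked :: "('a, 'm) monoid_scheme \<Rightarrow> 'a set \<Rightarrow> 'a set \<Rightarrow> 'a set \<Rightarrow> bool" where
  "spiked G G1 G2 S \<longleftrightarrow> S \<subseteq> G1 <#>\<^bsub>G\<^esub> G2 \<and> (\<exists>g1 \<in> G1. g1 <#\<^bsub>G\<^esub> G2 \<subseteq> S)"

definition spiked_base :: "('a, 'm) monoid_scheme \<Rightarrow> 'a set \<Rightarrow> 'a set \<Rightarrow> 'a set \<Rightarrow> 'a set" where
  "spiked_base G G1 G2 S = {g1 \<in> G1. g1 <#\<^bsub>G\<^esub> G2 \<subseteq> S}"

definition bounded_spiked ::
    "('a, 'm) monoid_scheme \<Rightarrow> 'a set \<Rightarrow> 'a set \<Rightarrow> nat \<Rightarrow> ('a \<Rightarrow> 'a) \<Rightarrow> ('a \<Rightarrow> nat \<Rightarrow> int) \<Rightarrow>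
     'a set \<Rightarrow> bool" where
  "bounded_spiked G G1 G2 r u \<phi> S \<longleftrightarrow>
     spiked G G1 G2 S \<and>
     spiked_base G G1 G2 S <#>\<^bsub>G\<^esub> G2 \<subseteq> S \<and>
     S \<subseteq> (spiked_base G G1 G2 S <#>\<^bsub>G\<^esub> G2) \<union>
         (\<Union>g1 \<in> G1 - spiked_base G G1 G2 S. g1 <#\<^bsub>G\<^esub> {g2 \<in> G2. \<phi> g2 \<in> lex_below r (\<phi> (u g1))})"

definition moderation ::
    "('a, 'm) monoid_scheme \<Rightarrow> 'a set \<Rightarrow> 'a set \<Rightarrow> nat \<Rightarrow> ('a \<Rightarrow> nat \<Rightarrow> int) \<Rightarrow> ('a \<Rightarrow> 'a) \<Rightarrow>
     ('a \<Rightarrow> 'a) \<Rightarrow> bool" where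
  "moderation G G1 G2 r \<phi> u v \<longleftrightarrow>
     v \<in> G1 \<rightarrow> G2 \<and>
     (\<forall>x0 \<in> G1. lex_bdd_above r ((\<lambda>x. \<phi> (v x \<otimes>\<^bsub>G\<^esub> u (x0 \<otimes>\<^bsub>G\<^esub> inv\<^bsub>G\<^esub> x))) ` G1))"

text \<open>
  A function \<open>u\<close> need not have a \<open>\<phi>\<close>-moderation when \<open>G1\<close> is uncountable (for \<open>G1 = \<real>\<close> and
  \<open>G2 = \<int>\<close>, take \<open>u 0 = 0\<close> and \<open>u t = \<lceil>1/\<bar>t\<bar>\<rceil>\<close> otherwise); the following predicate then
  holds vacuously, so an existence claim about it has to ask separately for a moderation of \<open>u\<close>.
\<close>

definition moderations_give_complements ::
    "('a, 'm) monoid_scheme \<Rightarrow> 'a set \<Rightarrow> 'a set \<Rightarrow> nat \<Rightarrow> ('a \<Rightarrow> nat \<Rightarrow> int) \<Rightarrow> ('a \<Rightarrow> 'a) \<Rightarrow>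
     'a set \<Rightarrow> bool" where
  "moderations_give_complements G G1 G2 r \<phi> u S \<longleftrightarrow>
     (\<forall>v. moderation G G1 G2 r \<phi> u v \<longrightarrow>
        (\<exists>M' \<subseteq> G1. is_minimal_complement (G\<lparr>carrier := G1 <#>\<^bsub>G\<^esub> G2\<rparr>) S
                      ((\<lambda>x. x \<otimes>\<^bsub>G\<^esub> v x) ` M')))"

end

theory Submission
  imports Defs
begin

text \<open>
  Between \<open>G\<close> and \<open>G1\<close>, minimal complements of \<open>B\<close> are exchanged by intersecting with \<open>G1\<close> and by
  adding a transversal of \<open>G1\<close>. The statements on spiked sets reduce to one equivalence: for
  \<open>N \<subseteq> G1\<close>, the graph of a moderation \<open>v\<close> over \<open>N\<close> is a complement of the spiked set \<open>S\<close> with base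
  \<open>B\<close> in \<open>G1 + G2\<close> iff \<open>N\<close> is a complement of \<open>B\<close> in \<open>G1\<close>. Indeed, if \<open>y \<in> G1\<close> lies outside
  \<open>B + N\<close>, then boundedness of \<open>S\<close> confines the part of \<open>y + G2\<close> covered by \<open>S\<close> plus the graph to
  elements strictly below a bound of \<open>x \<mapsto> \<phi> (v x + u (y - x))\<close>, so \<open>y + G2\<close> is not covered;
  conversely \<open>B + G2 \<subseteq> S\<close>, and \<open>G2\<close> absorbs the values of \<open>v\<close>. Applied to \<open>N\<close> and to \<open>N\<close> minus a
  point, this transfers minimality in both directions.
\<close>

section \<open>Minimal complements in a group and in a subgroup\<close>

lemma is_minimal_complement_subgroup_iff:
  assumes "subgroup H G" "B \<subseteq> H" "B \<noteq> {}"
  shows "is_minimal_complement (G\<lparr>carrier := H\<rparr>) B M \<longleftrightarrow>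
    M \<subseteq> H \<and> B <#>\<^bsub>G\<^esub> M = H \<and> (\<forall>w \<in> M. B <#>\<^bsub>G\<^esub> (M - {w}) \<noteq> H)"
proof -
  \<comment> \<open>Nonemptiness of \<open>M\<close> comes for free: a product set with empty
    \<open>M\<close> would be empty, while \<open>H\<close> contains the identity.\<close>
  have "M \<noteq> {}" if "B <#>\<^bsub>G\<^esub> M = H"
    using that subgroup.one_closed[OF assms(1)] by (auto simp: set_mult_def)
  then show ?thesis
    using assms by (auto simp: is_minimal_complement_def is_complement_def set_mult_def)
qed

text \<open>One representative is chosen from each right coset of \<open>H\<close>. The separation
  clause is phrased through products so that it applies directly to two factorisations of one
  element.\<close>

lemma (in group) transversal_exists:
  assumes "subgroup H G"
  obtains T where "T \<subseteq> carrier G" "H <#> T = carrier G"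
    "\<And>s t h k. \<lbrakk>s \<in> T; t \<in> T; h \<in> H; k \<in> H; h \<otimes> s = k \<otimes> t\<rbrakk> \<Longrightarrow> s = t"
proof -
  interpret H: subgroup H G by fact
  define f where "f g = (SOME x. x \<in> H #> g)" for g
  have f: "f g \<in> H #> g" if "g \<in> carrier G" for g
    unfolding f_def using rcos_self[OF that assms] by (rule someI)
  have fc: "f g \<in> carrier G" if "g \<in> carrier G" for g
    using f[OF that] that r_coset_subset_G[OF H.subset that] by blast
  have coset: "H #> f g = H #> g" if "g \<in> carrier G" for g
    using repr_independence[OF f[OF that] that assms] by simp
  show thesis
  proof (rule that[of "f ` carrier G"])
    show "f ` carrier G \<subseteq> carrier G" using fc by blast
    show "H <#> f ` carrier G = carrier G"
    proof
      show "H <#> f ` carrier G \<subseteq> carrier G"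
        using set_mult_closed[OF H.subset] fc by blast
      show "carrier G \<subseteq> H <#> f ` carrier G"
      proof
        fix g assume g: "g \<in> carrier G"
        have "g \<in> H #> f g" using rcos_self[OF g assms] coset[OF g] by simp
        then show "g \<in> H <#> f ` carrier G"
          using g by (auto simp: r_coset_def set_mult_def)
      qed
    qed
  next
    fix s t h k
    assume st: "s \<in> f ` carrier G" "t \<in> f ` carrier G" and hk: "h \<in> H" "k \<in> H"
      and eq: "h \<otimes> s = k \<otimes> t"
    from st obtain a b where ab: "a \<in> carrier G" "b \<in> carrier G" "s = f a" "t = f b" by blast
    have "H #> s = H #> (h \<otimes> s)"
      using repr_independence[of "h \<otimes> s" H s] hk ab fc assms by (auto simp: r_coset_def)
    also have "\<dots> = H #> t"
      unfolding eq using repr_independence[of "k \<otimes> t" H t] hk ab fc assms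
      by (auto simp: r_coset_def)
    finally have "H #> a = H #> b" using coset ab by simp
    \<comment> \<open>The representative \<open>f a\<close> depends on \<open>a\<close> only through
      its coset.\<close>
    then show "s = t" using ab by (simp add: f_def)
  qed
qed

text \<open>For \<open>b \<in> B\<close>, \<open>m \<in> carrier G\<close>, the product
  \<open>b \<otimes> m\<close> lies in \<open>H\<close> exactly when \<open>m\<close> does, so only
  \<open>M \<inter> H\<close> serves to cover \<open>H\<close>. Likewise, in a product
  \<open>M <#> T\<close> with a transversal \<open>T\<close>, only the translate of \<open>M\<close>
  by \<open>t\<close> serves to cover the coset \<open>H #> t\<close>.\<close>

lemma (in group) minimal_complement_in_subgroup_iff:
  assumes H: "subgroup H G" and B: "B \<subseteq> H" "B \<noteq> {}"
  shows "(\<exists>M. is_minimal_complement G B M) \<longleftrightarrow>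
    (\<exists>M. is_minimal_complement (G\<lparr>carrier := H\<rparr>) B M)"
proof
  interpret H: subgroup H G by fact
  note iff = is_minimal_complement_subgroup_iff[OF assms]
  have G_iff: "is_minimal_complement G B M \<longleftrightarrow>
    M \<subseteq> carrier G \<and> B <#> M = carrier G \<and> (\<forall>w \<in> M. B <#> (M - {w}) \<noteq> carrier G)" for M
    using is_minimal_complement_subgroup_iff[OF subgroup_self, of B M] B H.subset
    by (auto simp: is_minimal_complement_def is_complement_def set_mult_def)
  {
    assume "\<exists>M. is_minimal_complement G B M"
    then obtain M where M: "M \<subseteq> carrier G" "B <#> M = carrier G"
      "\<And>w. w \<in> M \<Longrightarrow> B <#> (M - {w}) \<noteq> carrier G"
      unfolding G_iff by blast
    have cov: "\<exists>b\<in>B. \<exists>m\<in>M. g = b \<otimes> m" if "g \<in> carrier G" for g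
      using that unfolding M(2)[symmetric] by (auto simp: set_mult_def)
    have in_H: "m \<in> H" if "b \<in> B" "m \<in> M" "b \<otimes> m \<in> H" for b m
    proof -
      have "m = inv b \<otimes> (b \<otimes> m)"
        using that(1,2) B(1) M(1) H.subset by (simp add: subset_iff m_assoc[symmetric])
      moreover have "inv b \<otimes> (b \<otimes> m) \<in> H" using that B by blast
      ultimately show ?thesis by simp
    qed
    have "is_minimal_complement (G\<lparr>carrier := H\<rparr>) B (M \<inter> H)"
      unfolding iff
    proof (intro conjI ballI notI)
      show "B <#> (M \<inter> H) = H"
      proof
        show "B <#> (M \<inter> H) \<subseteq> H" using B(1) unfolding set_mult_def by blast
        show "H \<subseteq> B <#> (M \<inter> H)"
        proof
          fix h assume "h \<in> H"
          then obtain b m where "b \<in> B" "m \<in> M" "h = b \<otimes> m"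
            using cov[OF H.mem_carrier] by blast
          moreover from this have "m \<in> H" using in_H \<open>h \<in> H\<close> by blast
          ultimately show "h \<in> B <#> (M \<inter> H)" unfolding set_mult_def by blast
        qed
      qed
    next
      fix w assume w: "w \<in> M \<inter> H" and eq: "B <#> (M \<inter> H - {w}) = H"
      have "carrier G \<subseteq> B <#> (M - {w})"
      proof
        fix g assume "g \<in> carrier G"
        then obtain b m where bm: "b \<in> B" "m \<in> M" "g = b \<otimes> m" using cov by blast
        show "g \<in> B <#> (M - {w})"
        proof (cases "m = w")
          \<comment> \<open>Here \<open>g = b \<otimes> w\<close> lies in \<open>H\<close>, which by
            \<open>eq\<close> is still covered once \<open>w\<close> is dropped.\<close>
          case True
          then have "g \<in> B <#> (M \<inter> H - {w})" using eq bm w B by auto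
          then show ?thesis by (auto simp: set_mult_def)
        next
          case False
          then show ?thesis using bm by (auto simp: set_mult_def)
        qed
      qed
      moreover have "B <#> (M - {w}) \<subseteq> carrier G" using M(2) by (auto simp: set_mult_def)
      ultimately show False using M(3)[of w] w by blast
    qed simp
    then show "\<exists>M. is_minimal_complement (G\<lparr>carrier := H\<rparr>) B M" by blast
  next
    assume "\<exists>M. is_minimal_complement (G\<lparr>carrier := H\<rparr>) B M"
    then obtain M where M: "M \<subseteq> H" "B <#> M = H" "\<And>w. w \<in> M \<Longrightarrow> B <#> (M - {w}) \<noteq> H"
      unfolding iff by blast
    obtain T where T: "T \<subseteq> carrier G" "H <#> T = carrier G"
      "\<And>s t h k. \<lbrakk>s \<in> T; t \<in> T; h \<in> H; k \<in> H; h \<otimes> s = k \<otimes> t\<rbrakk> \<Longrightarrow> s = t"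
      using transversal_exists[OF H] by metis
    have MT: "M <#> T \<subseteq> carrier G" using M(1) T(1) H.subset by (rule_tac set_mult_closed) auto
    have "is_minimal_complement G B (M <#> T)"
      unfolding G_iff
    proof (intro conjI ballI notI)
      show "B <#> (M <#> T) = carrier G"
        using set_mult_assoc[of B M T] B M T H.subset by auto
    next
      fix w assume "w \<in> M <#> T" and eq: "B <#> ((M <#> T) - {w}) = carrier G"
      then obtain m t where mt: "m \<in> M" "t \<in> T" "w = m \<otimes> t" by (auto simp: set_mult_def)
      have "B <#> (M - {m}) \<subseteq> H" using M(2) by (auto simp: set_mult_def)
      \<comment> \<open>The element \<open>h\<close> is lost when \<open>m\<close> is removed from
        \<open>M\<close>; its translate \<open>h \<otimes> t\<close> will be lost when
        \<open>m \<otimes> t\<close> is removed from \<open>M <#> T\<close>.\<close>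
      then obtain h where h: "h \<in> H" "h \<notin> B <#> (M - {m})" using M(3)[OF mt(1)] by blast
      have "h \<otimes> t \<in> B <#> ((M <#> T) - {w})" using h mt T(1) unfolding eq by auto
      then obtain b m' t' where *: "b \<in> B" "m' \<in> M" "t' \<in> T" "m' \<otimes> t' \<noteq> w"
        "h \<otimes> t = b \<otimes> (m' \<otimes> t')"
        by (auto simp: set_mult_def)
      have car: "b \<in> carrier G" "m' \<in> carrier G" "t' \<in> carrier G" "t \<in> carrier G" "h \<in> carrier G"
        using * h mt B M(1) T(1) by auto
      have eq': "h \<otimes> t = (b \<otimes> m') \<otimes> t'" using * car by (simp add: m_assoc)
      have "b \<otimes> m' \<in> H" using * B M(1) by blast
      \<comment> \<open>Both sides of \<open>eq'\<close> lie in one coset of \<open>H\<close>.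
        Cancelling \<open>t\<close> then expresses \<open>h\<close> using some
        \<open>m' \<noteq> m\<close>, against the choice of \<open>h\<close>.\<close>
      then have "t = t'" using T(3)[OF _ _ _ _ eq'] mt * h by blast
      then have "h = b \<otimes> m'" "m' \<noteq> m" using eq' car * mt by auto
      then show False using h * by (auto simp: set_mult_def)
    qed (use MT in simp)
    then show "\<exists>M. is_minimal_complement G B M" by blast
  }
qed

section \<open>The lexicographically ordered group of integer vectors\<close>

lemma int_power_group_simps:
  "carrier (int_power_group r) = extensional {..<r}"
  "x \<otimes>\<^bsub>int_power_group r\<^esub> y = (\<lambda>i\<in>{..<r}. x i + y i)"
  by (auto simp: int_power_group_def PiE_def)

lemma group_int_power_group: "group (int_power_group r)"
  by (simp add: int_power_group_def)

text \<open>Adding \<open>c\<close> preserves the first index of difference and the inequality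
  there. That index is below \<open>r\<close>, since both vectors are \<open>undefined\<close> from
  \<open>r\<close> on; this matters because the sum is computed only below \<open>r\<close>.\<close>

lemma less_fun_int_power_group_mult_left:
  assumes "a \<in> carrier (int_power_group r)" "b \<in> carrier (int_power_group r)" "less_fun a b"
  shows "less_fun (c \<otimes>\<^bsub>int_power_group r\<^esub> a) (c \<otimes>\<^bsub>int_power_group r\<^esub> b)"
proof -
  obtain k where k: "a k < b k" "\<And>k'. k' < k \<Longrightarrow> a k' = b k'"
    using assms(3) by (auto elim: less_funE)
  have "k < r"
    using k(1) assms(1,2) by (cases "k < r") (auto simp: int_power_group_simps extensional_def)
  then show ?thesis
    using k by (intro less_funI exI[of _ k]) (auto simp: int_power_group_simps)
qed

text \<open>Over the finite index set \<open>{..<r}\<close> the finite support condition is void, so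
  direct sum and direct product coincide.\<close>

lemma free_abelian_of_rank_iso_int_power_group:
  assumes "group H" "free_abelian_of_rank H r"
  shows "iso H (int_power_group r) \<noteq> {}"
proof -
  have "free_Abelian_group {..<r} \<cong> sum_group {..<r} (\<lambda>_. integer_group)"
    using isomorphic_sum_integer_group[of "{..<r}"] by (simp add: group.iso_sym)
  moreover have "sum_group {..<r} (\<lambda>_. integer_group) = int_power_group r"
  proof (rule monoid.equality)
    show "carrier (sum_group {..<r} (\<lambda>_. integer_group)) = carrier (int_power_group r)"
      by (simp add: carrier_sum_group int_power_group_def)
  qed (auto simp: int_power_group_def)
  ultimately have "H \<cong> int_power_group r"
    using assms iso_trans unfolding free_abelian_of_rank_def by metis
  then show ?thesis by (simp add: is_iso_def)
qed

section \<open>Graphs over \<open>G1\<close> inside the direct sum of \<open>G1\<close> and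
  \<open>G2\<close>\<close>

locale complemented_subgroups = comm_group G + G1: subgroup G1 G + G2: subgroup G2 G
  for G (structure) and G1 G2 +
  assumes disjoint: "G1 \<inter> G2 = {\<one>}"
begin

text \<open>The quotients \<open>inv a' \<otimes> a\<close> and \<open>b' \<otimes> inv b\<close>
  are equal and lie in the two subgroups, hence in their trivial intersection.\<close>

lemma decomposition_unique:
  assumes "a \<in> G1" "a' \<in> G1" "b \<in> G2" "b' \<in> G2" "a \<otimes> b = a' \<otimes> b'"
  shows "a = a'" "b = b'"
proof -
  have car: "a \<in> carrier G" "a' \<in> carrier G" "b \<in> carrier G" "b' \<in> carrier G"
    using assms by auto
  have "inv a' \<otimes> a = b' \<otimes> inv b"
  proof -
    have "a = (a \<otimes> b) \<otimes> inv b" using car by (simp add: m_assoc)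
    then have "a = (a' \<otimes> b') \<otimes> inv b" unfolding assms(5) .
    then show ?thesis using car by (simp add: m_assoc inv_solve_left')
  qed
  moreover have "inv a' \<otimes> a \<in> G1" "b' \<otimes> inv b \<in> G2" using assms by auto
  ultimately have "inv a' \<otimes> a = \<one>" using disjoint by auto
  then show "a = a'" using car inv_solve_left'[of \<one> a' a] by simp
  then show "b = b'" using assms(5) car by simp
qed

lemma subgroup_sum: "subgroup (G1 <#> G2) G"
  using mult_subgroups[OF G1.subgroup_axioms G2.subgroup_axioms] .

lemma graph_complement_iff:
  assumes phi: "\<phi> \<in> iso (G\<lparr>carrier := G2\<rparr>) (int_power_group r)"
    and u: "u \<in> G1 \<rightarrow> G2"
    and S: "bounded_spiked G G1 G2 r u \<phi> S"
    and v: "moderation G G1 G2 r \<phi> u v"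
    and N: "N \<subseteq> G1"
  shows "S <#> (\<lambda>x. x \<otimes> v x) ` N = G1 <#> G2 \<longleftrightarrow> spiked_base G G1 G2 S <#> N = G1"
    (is "?L \<longleftrightarrow> ?R")
proof
  define B where "B = spiked_base G G1 G2 S"
  have BG1: "B \<subseteq> G1" by (auto simp: B_def spiked_base_def)
  have vG2: "v x \<in> G2" if "x \<in> G1" for x using v that by (auto simp: moderation_def)
  have uG2: "u x \<in> G2" if "x \<in> G1" for x using u that by auto
  have SG: "S \<subseteq> G1 <#> G2" using S by (auto simp: bounded_spiked_def spiked_def)
  {
    assume ?R
    then have R: "B <#> N = G1" by (simp add: B_def)
    show ?L
    proof
      have "(\<lambda>x. x \<otimes> v x) ` N \<subseteq> G1 <#> G2" using N vG2 by (auto simp: set_mult_def)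
      then show "S <#> (\<lambda>x. x \<otimes> v x) ` N \<subseteq> G1 <#> G2"
        using SG subgroup.m_closed[OF subgroup_sum] by (auto simp: set_mult_def[of G S])
      show "G1 <#> G2 \<subseteq> S <#> (\<lambda>x. x \<otimes> v x) ` N"
      proof
        fix g assume "g \<in> G1 <#> G2"
        then obtain y z where yz: "y \<in> G1" "z \<in> G2" "g = y \<otimes> z" by (auto simp: set_mult_def)
        then obtain b x where bx: "b \<in> B" "x \<in> N" "y = b \<otimes> x"
          using R by (auto simp: set_mult_def)
        have x: "x \<in> G1" and b: "b \<in> G1" using bx N BG1 by auto
        \<comment> \<open>The whole fibre \<open>b <# G2\<close> lies in \<open>S\<close>, so the
          shift by \<open>v x\<close> can be undone inside it.\<close>
        have "b \<otimes> (z \<otimes> inv (v x)) \<in> S"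
          using bx(1) yz vG2[OF x] S
          by (auto simp: B_def spiked_base_def l_coset_def)
        moreover have "g = (b \<otimes> (z \<otimes> inv (v x))) \<otimes> (x \<otimes> v x)"
        proof -
          have c: "b \<in> carrier G" "z \<in> carrier G" "v x \<in> carrier G" "x \<in> carrier G"
            using b yz vG2[OF x] x by auto
          have "(b \<otimes> (z \<otimes> inv (v x))) \<otimes> (x \<otimes> v x) = (b \<otimes> x) \<otimes> z \<otimes> (inv (v x) \<otimes> v x)"
            using c by (simp only: m_ac m_closed inv_closed)
          then show ?thesis using c yz bx by simp
        qed
        ultimately show "g \<in> S <#> (\<lambda>x. x \<otimes> v x) ` N"
          using bx by (auto simp: set_mult_def)
      qed
    qed
  next
    assume L: ?L
    have "y \<in> B <#> N" if y: "y \<in> G1" for y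
    proof (rule ccontr)
      assume nin: "y \<notin> B <#> N"
      \<comment> \<open>Moderation at the point \<open>y\<close> gives one bound valid for all
        \<open>x\<close> at once.\<close>
      obtain \<beta> where \<beta>: "\<beta> \<in> carrier (int_power_group r)"
        "\<And>x. x \<in> G1 \<Longrightarrow> less_fun (\<phi> (v x \<otimes> u (y \<otimes> inv x))) \<beta> \<or> \<phi> (v x \<otimes> u (y \<otimes> inv x)) = \<beta>"
        using v y unfolding moderation_def lex_bdd_above_def by blast
      have "\<phi> ` G2 = carrier (int_power_group r)"
        using phi by (auto simp: iso_def bij_betw_def)
      \<comment> \<open>The point \<open>y \<otimes> z\<close> sits exactly at the bound, while any
        covered point over \<open>y\<close> must sit strictly below it.\<close>
      then obtain z where z: "z \<in> G2" "\<phi> z = \<beta>" using \<beta>(1) by (metis imageE)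
      have hom: "\<phi> (p \<otimes> q) = \<phi> p \<otimes>\<^bsub>int_power_group r\<^esub> \<phi> q" if "p \<in> G2" "q \<in> G2" for p q
        using phi that by (auto simp: iso_def hom_def)
      have phic: "\<phi> p \<in> carrier (int_power_group r)" if "p \<in> G2" for p
        using phi that by (auto simp: iso_def hom_def)
      have "y \<otimes> z \<in> S <#> (\<lambda>x. x \<otimes> v x) ` N" using L y z by (auto simp: set_mult_def)
      then obtain s x where sx: "s \<in> S" "x \<in> N" "y \<otimes> z = s \<otimes> (x \<otimes> v x)"
        by (auto simp: set_mult_def)
      obtain p q where pq: "p \<in> G1" "q \<in> G2" "s = p \<otimes> q" using sx SG by (auto simp: set_mult_def)
      have x: "x \<in> G1" using sx N by auto
      have car: "p \<in> carrier G" "q \<in> carrier G" "x \<in> carrier G" "v x \<in> carrier G" "y \<in> carrier G"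
        using pq x vG2[OF x] y by auto
      have "y \<otimes> z = (p \<otimes> x) \<otimes> (v x \<otimes> q)"
        using sx(3) pq(3) car by (simp add: m_ac)
      then have eqs: "y = p \<otimes> x" "z = v x \<otimes> q"
        using decomposition_unique[of y "p \<otimes> x" z "v x \<otimes> q"] y z pq x vG2[OF x] by auto
      have pB: "p \<notin> B" using nin eqs sx by (auto simp: set_mult_def)
      have p_eq: "p = y \<otimes> inv x" using eqs car by (simp add: m_assoc)
      have "less_fun (\<phi> q) (\<phi> (u p))"
      proof -
        have "s \<in> (B <#> G2) \<union> (\<Union>g1 \<in> G1 - B. g1 <# {g2 \<in> G2. \<phi> g2 \<in> lex_below r (\<phi> (u g1))})"
          using S sx(1) by (auto simp: bounded_spiked_def B_def)
        \<comment> \<open>The \<open>G1\<close>-component of \<open>s\<close> is \<open>p\<close>,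
          which is outside the base, so \<open>s\<close> must come from one of the bounded
          fibres.\<close>
        moreover have "s \<notin> B <#> G2"
          using pB BG1 pq decomposition_unique(1)[OF pq(1)] by (fastforce simp: set_mult_def)
        ultimately obtain p' q' where pq': "p' \<in> G1" "q' \<in> G2" "s = p' \<otimes> q'"
          and below: "\<phi> q' \<in> lex_below r (\<phi> (u p'))"
          unfolding l_coset_def by blast
        have "p' = p" "q' = q"
          using decomposition_unique[OF pq'(1) pq(1) pq'(2) pq(2)] pq'(3) pq(3) by auto
        then show ?thesis using below by (simp add: lex_below_def)
      qed
      then have "less_fun (\<phi> (v x \<otimes> q)) (\<phi> (v x \<otimes> u p))"
        unfolding hom[OF vG2[OF x] pq(2)] hom[OF vG2[OF x] uG2[OF pq(1)]]
        using less_fun_int_power_group_mult_left phic[OF pq(2)] phic[OF uG2[OF pq(1)]] by blast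
      \<comment> \<open>With \<open>z = v x \<otimes> q\<close> and
        \<open>p = y \<otimes> inv x\<close>, the value \<open>\<beta>\<close> falls strictly below
        a value that it bounds.\<close>
      then have "less_fun \<beta> (\<phi> (v x \<otimes> u (y \<otimes> inv x)))"
        unfolding p_eq[symmetric] eqs(2)[symmetric] z(2) .
      then show False using \<beta>(2)[OF x] less_fun_asym by metis
    qed
    moreover have "B <#> N \<subseteq> G1" using BG1 N by (auto simp: set_mult_def)
    ultimately show ?R unfolding B_def by blast
  }
qed

text \<open>The graph map is injective on \<open>G1\<close>, so deleting a point of the graph
  amounts to deleting a point of \<open>N\<close>; the complement criterion then applies to
  \<open>N\<close> and to each \<open>N - {w}\<close>.\<close>

lemma graph_minimal_complement_iff:
  assumes phi: "\<phi> \<in> iso (G\<lparr>carrier := G2\<rparr>) (int_power_group r)"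
    and u: "u \<in> G1 \<rightarrow> G2"
    and S: "bounded_spiked G G1 G2 r u \<phi> S"
    and v: "moderation G G1 G2 r \<phi> u v"
    and N: "N \<subseteq> G1"
  shows "is_minimal_complement (G\<lparr>carrier := G1 <#> G2\<rparr>) S ((\<lambda>x. x \<otimes> v x) ` N) \<longleftrightarrow>
    is_minimal_complement (G\<lparr>carrier := G1\<rparr>) (spiked_base G G1 G2 S) N"
proof -
  let ?g = "\<lambda>x. x \<otimes> v x"
  have vG2: "v x \<in> G2" if "x \<in> G1" for x using v that by (auto simp: moderation_def)
  have base: "spiked_base G G1 G2 S \<subseteq> G1" "spiked_base G G1 G2 S \<noteq> {}"
    using S by (auto simp: spiked_base_def bounded_spiked_def spiked_def)
  have SG: "S \<subseteq> G1 <#> G2" using S by (auto simp: bounded_spiked_def spiked_def)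
  have "G2 \<noteq> {}" using G2.one_closed by blast
  then have S_ne: "S \<noteq> {}"
    using S by (auto simp: bounded_spiked_def spiked_def l_coset_def)
  have inj: "inj_on ?g G1" using decomposition_unique(1)[OF _ _ vG2 vG2] by (auto intro!: inj_onI)
  have graph: "?g ` N \<subseteq> G1 <#> G2" using N vG2 by (auto simp: set_mult_def)
  have diff: "?g ` N - {?g w} = ?g ` (N - {w})" if "w \<in> N" for w
    using inj_on_image_set_diff[OF inj, of N "{w}"] N that by auto
  have iff: "S <#> ?g ` K = G1 <#> G2 \<longleftrightarrow> spiked_base G G1 G2 S <#> K = G1" if "K \<subseteq> N" for K
    using graph_complement_iff[OF phi u S v] that N by blast
  show ?thesis
    unfolding is_minimal_complement_subgroup_iff[OF subgroup_sum SG S_ne]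
      is_minimal_complement_subgroup_iff[OF G1.subgroup_axioms base]
    using graph N iff[of N] iff[of "N - {_}"] by (auto simp: diff)
qed

text \<open>A single moderation already turns the left side into a minimal complement of the base.
  Its existence is assumed because the left side is vacuous for a \<open>u\<close> that has
  none.\<close>

lemma moderations_give_complements_iff:
  assumes "\<phi> \<in> iso (G\<lparr>carrier := G2\<rparr>) (int_power_group r)"
    and "u \<in> G1 \<rightarrow> G2"
    and "bounded_spiked G G1 G2 r u \<phi> S"
    and "\<exists>v. moderation G G1 G2 r \<phi> u v"
  shows "moderations_give_complements G G1 G2 r \<phi> u S \<longleftrightarrow>
    (\<exists>M. is_minimal_complement (G\<lparr>carrier := G1\<rparr>) (spiked_base G G1 G2 S) M)"
proof -
  have "M \<subseteq> G1" if "is_minimal_complement (G\<lparr>carrier := G1\<rparr>) (spiked_base G G1 G2 S) M" for M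
    using that by (simp add: is_minimal_complement_def is_complement_def)
  then show ?thesis
    using graph_minimal_complement_iff[OF assms(1-3)] assms(4)
    unfolding moderations_give_complements_def by metis
qed

section \<open>A spiked set and a moderation for every base\<close>

lemma spiked_base_set_mult:
  assumes "B \<subseteq> G1"
  shows "spiked_base G G1 G2 (B <#> G2) = B"
proof -
  have "g \<in> B" if "g \<in> G1" "g <# G2 \<subseteq> B <#> G2" for g
  proof -
    have "g \<otimes> \<one> \<in> g <# G2" using G2.one_closed by (force simp: l_coset_def)
    then have "g \<otimes> \<one> \<in> B <#> G2" using that(2) by blast
    then obtain b z where bz: "b \<in> B" "z \<in> G2" "g \<otimes> \<one> = b \<otimes> z" by (auto simp: set_mult_def)
    then show ?thesis
      using decomposition_unique(1)[of g b \<one> z] that(1) assms G2.one_closed by auto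
  qed
  then show ?thesis using assms by (auto simp: spiked_base_def l_coset_def set_mult_def)
qed

text \<open>\<open>B <#> G2\<close> meets no fibre over a point of \<open>G1\<close> outside
  \<open>B\<close>, so the upper inclusion holds whatever \<open>u\<close> and \<open>\<phi>\<close>
  are. This set serves as witness for the existential statement and as test case for the universal
  one.\<close>

lemma bounded_spiked_set_mult:
  assumes "B \<subseteq> G1" "B \<noteq> {}"
  shows "bounded_spiked G G1 G2 r u \<phi> (B <#> G2)"
proof -
  have "B <#> G2 \<subseteq> G1 <#> G2" using assms by (auto simp: set_mult_def)
  moreover have "\<exists>g1\<in>G1. g1 <# G2 \<subseteq> B <#> G2"
    using assms by (auto simp: l_coset_def set_mult_def)
  ultimately show ?thesis
    by (simp add: bounded_spiked_def spiked_def spiked_base_set_mult[OF assms(1)])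
qed

lemma moderation_one:
  assumes "\<phi> \<in> iso (G\<lparr>carrier := G2\<rparr>) (int_power_group r)"
  shows "moderation G G1 G2 r \<phi> (\<lambda>_. \<one>) (\<lambda>_. \<one>)"
proof -
  have "\<phi> \<one> \<in> carrier (int_power_group r)"
    using assms G2.one_closed by (auto simp: iso_def hom_def)
  then show ?thesis by (auto simp: moderation_def lex_bdd_above_def)
qed

end

section \<open>Equivalence of the four statements\<close>

theorem theorem5p6:
  fixes G :: "('a, 'm) monoid_scheme" and G1 G2 B :: "'a set" and r :: nat
  assumes "comm_group G"
    and "subgroup G1 G"
    and "subgroup G2 G"
    and "G1 \<inter> G2 = {\<one>\<^bsub>G\<^esub>}"
    and "r > 0"
    and "free_abelian_of_rank (G\<lparr>carrier := G2\<rparr>) r"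
    and "B \<subseteq> G1"
    and "B \<noteq> {}"
  shows "((\<exists>M. is_minimal_complement G B M) \<longleftrightarrow>
          (\<exists>M. is_minimal_complement (G\<lparr>carrier := G1\<rparr>) B M))
       \<and> ((\<exists>M. is_minimal_complement (G\<lparr>carrier := G1\<rparr>) B M) \<longleftrightarrow>
          (\<forall>u \<in> G1 \<rightarrow> G2. \<forall>\<phi> \<in> iso (G\<lparr>carrier := G2\<rparr>) (int_power_group r). \<forall>S.
             bounded_spiked G G1 G2 r u \<phi> S \<and> spiked_base G G1 G2 S = B \<longrightarrow>
             moderations_give_complements G G1 G2 r \<phi> u S))
       \<and> ((\<exists>M. is_minimal_complement (G\<lparr>carrier := G1\<rparr>) B M) \<longleftrightarrow>
          (\<exists>u \<in> G1 \<rightarrow> G2. \<exists>\<phi> \<in> iso (G\<lparr>carrier := G2\<rparr>) (int_power_group r). \<exists>S.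
             bounded_spiked G G1 G2 r u \<phi> S \<and> spiked_base G G1 G2 S = B \<and>
             (\<exists>v. moderation G G1 G2 r \<phi> u v) \<and>
             moderations_give_complements G G1 G2 r \<phi> u S))"
proof -
  interpret comm_group G by fact
  interpret complemented_subgroups G G1 G2
    by (intro complemented_subgroups.intro complemented_subgroups_axioms.intro assms)
  note iff = moderations_give_complements_iff
  let ?MC = "\<exists>M. is_minimal_complement (G\<lparr>carrier := G1\<rparr>) B M"
  let ?P = "\<lambda>u \<phi> S. bounded_spiked G G1 G2 r u \<phi> S \<and> spiked_base G G1 G2 S = B"
  have "group (G\<lparr>carrier := G2\<rparr>)"
    by (rule subgroup_imp_group) fact
  \<comment> \<open>Freeness of \<open>G2\<close> supplies an isomorphism, without which the
    universal statement would be vacuous.\<close>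
  then obtain \<psi> where \<psi>: "\<psi> \<in> iso (G\<lparr>carrier := G2\<rparr>) (int_power_group r)"
    using free_abelian_of_rank_iso_int_power_group assms(6) by blast
  have one: "(\<lambda>_. \<one>\<^bsub>G\<^esub>) \<in> G1 \<rightarrow> G2" by auto
  have P: "?P (\<lambda>_. \<one>\<^bsub>G\<^esub>) \<psi> (B <#>\<^bsub>G\<^esub> G2)"
    using bounded_spiked_set_mult spiked_base_set_mult assms by simp
  have mod: "\<exists>v. moderation G G1 G2 r \<psi> (\<lambda>_. \<one>\<^bsub>G\<^esub>) v"
    using moderation_one[OF \<psi>] by blast
  \<comment> \<open>If \<open>u\<close> has a moderation, \<open>iff\<close> applies; otherwise the
    claim is vacuous.\<close>
  have all: "moderations_give_complements G G1 G2 r \<phi> u S"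
    if "?MC" "u \<in> G1 \<rightarrow> G2" "\<phi> \<in> iso (G\<lparr>carrier := G2\<rparr>) (int_power_group r)" "?P u \<phi> S" for u \<phi> S
    using that iff[of \<phi> r u S] by (auto simp: moderations_give_complements_def)
  have ex: "?MC"
    if "u \<in> G1 \<rightarrow> G2" "\<phi> \<in> iso (G\<lparr>carrier := G2\<rparr>) (int_power_group r)" "?P u \<phi> S"
      "\<exists>v. moderation G G1 G2 r \<phi> u v" "moderations_give_complements G G1 G2 r \<phi> u S" for u \<phi> S
    using that iff[of \<phi> r u S] by auto
  show ?thesis
  proof (intro conjI)
    show "(\<exists>M. is_minimal_complement G B M) \<longleftrightarrow> ?MC"
      using minimal_complement_in_subgroup_iff assms by blast
  next
    \<comment> \<open>For the backward direction, the universal statement is specialised to the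
      constant \<open>u\<close>, to \<open>\<psi>\<close> and to \<open>B <#> G2\<close>, where a
      moderation exists.\<close>
    show "?MC \<longleftrightarrow>
      (\<forall>u \<in> G1 \<rightarrow> G2. \<forall>\<phi> \<in> iso (G\<lparr>carrier := G2\<rparr>) (int_power_group r). \<forall>S.
        ?P u \<phi> S \<longrightarrow> moderations_give_complements G G1 G2 r \<phi> u S)"
      using all ex[OF one \<psi> P mod] one \<psi> P by blast
  next
    show "?MC \<longleftrightarrow>
      (\<exists>u \<in> G1 \<rightarrow> G2. \<exists>\<phi> \<in> iso (G\<lparr>carrier := G2\<rparr>) (int_power_group r). \<exists>S.
        bounded_spiked G G1 G2 r u \<phi> S \<and> spiked_base G G1 G2 S = B \<and>
        (\<exists>v. moderation G G1 G2 r \<phi> u v) \<and> moderations_give_complements G G1 G2 r \<phi> u S)"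
      using all[OF _ one \<psi> P] ex one \<psi> P mod by blast
  qed
qed

end
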